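(* For every integer $s\ge1$ and $|x|<1$, $$\sum_{n=0}^{s-1}\frac{\binom{2n}{n}}{4^n(2n+1)}\prod_{j=1}^{n}\left(1-\frac{(2s-1)^2}{(2j-1)^2}\right)x^{2n+1}=\frac{\sin((2s-1)\arcsin x)}{2s-1}.$$ For every integer $s\ge1$ and $|x|<1$, $$\sum_{n=1}^{s}\frac{4^n}{n^2\binom{2n}{n}}\prod_{j=1}^{n-1}\left(1-\frac{s^2}{j^2}\right)x^{2n}=\frac{1-\cos(2s\arcsin x)}{s^2}.$$ Both identities extend as polynomial identities in $x$ (each right-hand side is a polynomial function of $x$, and the identities hold for all complex $x$).
   Context: $\arcsin$ is the principal inverse sine, $\arcsin w=-i\operatorname{Log}(iw+\sqrt{1-w^2})$ with principal logarithm and principal square root. *)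

theory Defs
  imports "HOL-Analysis.Analysis" "HOL-Computational_Algebra.Polynomial"
begin

definition odd_arcsin_sum :: "nat \<Rightarrow> complex \<Rightarrow> complex" where
  "odd_arcsin_sum s x =
     (\<Sum>n = 0..s - 1.
        of_nat (2 * n choose n) / (4 ^ n * (2 * of_nat n + 1)) *
        (\<Prod>j = 1..n. 1 - (2 * of_nat s - 1)\<^sup>2 / (2 * of_nat j - 1)\<^sup>2) *
        x ^ (2 * n + 1))"

definition even_arcsin_sum :: "nat \<Rightarrow> complex \<Rightarrow> complex" where
  "even_arcsin_sum s x =
     (\<Sum>n = 1..s.
        4 ^ n / ((of_nat n)\<^sup>2 * of_nat (2 * n choose n)) *
        (\<Prod>j = 1..n - 1. 1 - (of_nat s)\<^sup>2 / (of_nat j)\<^sup>2) *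
        x ^ (2 * n))"

end

theory Submission imports Defs begin

text \<open>
  Clearing denominators turns the two sums into
  \<open>\<Sum>n. m (1\<^sup>2 - m\<^sup>2) (3\<^sup>2 - m\<^sup>2) \<cdots> ((2n-1)\<^sup>2 - m\<^sup>2) x\<^sup>2\<^sup>n\<^sup>+\<^sup>1 / (2n+1)!\<close> with \<open>m = 2s - 1\<close> and
  \<open>\<Sum>n. (0\<^sup>2 - m\<^sup>2) (2\<^sup>2 - m\<^sup>2) \<cdots> ((2n-2)\<^sup>2 - m\<^sup>2) x\<^sup>2\<^sup>n / (2n)!\<close> with \<open>m = 2s\<close>. Since these products
  split into linear factors in arithmetic progression, the shifts \<open>m \<mapsto> m \<plusminus> 2\<close> change only the
  outer factors, and both sums satisfy \<open>F (m + 2) + F (m - 2) = (2 - 4 x\<^sup>2) F m\<close>. With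
  \<open>x = sin \<theta>\<close> this is the recurrence of \<open>sin (m \<theta>)\<close> and \<open>cos (m \<theta>)\<close>, because
  \<open>2 - 4 x\<^sup>2 = 2 cos (2 \<theta>)\<close>; so induction on \<open>s\<close> applies for every complex \<open>x\<close>.
\<close>

section \<open>Coefficient products and their behaviour under shifts of \<open>m\<close>\<close>

definition odd_coeff :: "complex \<Rightarrow> nat \<Rightarrow> complex" where
  "odd_coeff m n = (\<Prod>j = 1..n. (2 * of_nat j - 1)\<^sup>2 - m\<^sup>2)"

definition even_coeff :: "complex \<Rightarrow> nat \<Rightarrow> complex" where
  "even_coeff m n = (\<Prod>j<n. (2 * of_nat j)\<^sup>2 - m\<^sup>2)"

definition sin_sum :: "nat \<Rightarrow> complex \<Rightarrow> complex \<Rightarrow> complex" where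
  "sin_sum N m x = (\<Sum>n\<le>N. m * odd_coeff m n / fact (2 * n + 1) * x ^ (2 * n + 1))"

definition cos_sum :: "nat \<Rightarrow> complex \<Rightarrow> complex \<Rightarrow> complex" where
  "cos_sum N m x = (\<Sum>n\<le>N. even_coeff m n / fact (2 * n) * x ^ (2 * n))"

lemma odd_coeff_0 [simp]: "odd_coeff m 0 = 1"
  by (simp add: odd_coeff_def)

lemma odd_coeff_Suc: "odd_coeff m (Suc n) = odd_coeff m n * ((2 * of_nat n + 1)\<^sup>2 - m\<^sup>2)"
  by (simp add: odd_coeff_def algebra_simps)

lemma even_coeff_0 [simp]: "even_coeff m 0 = 1"
  by (simp add: even_coeff_def)

lemma even_coeff_Suc: "even_coeff m (Suc n) = even_coeff m n * ((2 * of_nat n)\<^sup>2 - m\<^sup>2)"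
  by (simp add: even_coeff_def)

lemma odd_coeff_minus: "odd_coeff (- m) n = odd_coeff m n"
  by (simp add: odd_coeff_def)

lemma even_coeff_minus: "even_coeff (- m) n = even_coeff m n"
  by (simp add: even_coeff_def)

text \<open>Split each factor as \<open>(2j-1-m)(2j-1+m)\<close>. The shift moves both progressions
  by one index: the first gains \<open>-1-m\<close> at the bottom, the second loses
  \<open>1+m\<close> and gains two factors at the top; the bottom factors cancel to
  \<open>-1\<close>.\<close>

lemma odd_coeff_shift:
  "odd_coeff (m + 2) (Suc n) = - (2 * of_nat n + 1 + m) * (2 * of_nat n + 3 + m) * odd_coeff m n"
proof (induction n)
  case (Suc n)
  show ?case
    unfolding odd_coeff_Suc[of "m + 2" "Suc n"] Suc.IH unfolding odd_coeff_Suc of_nat_Suc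
    by algebra
qed (simp add: odd_coeff_Suc power2_eq_square algebra_simps)

text \<open>Here the progression \<open>2j+m\<close> loses its bottom factor \<open>m\<close>, which
  is kept on the left to avoid a division.\<close>

lemma even_coeff_shift:
  "m * even_coeff (m + 2) (Suc n) =
     - (m + 2) * (2 * of_nat n + m) * (2 * of_nat n + 2 + m) * even_coeff m n"
proof (induction n)
  case (Suc n)
  have "m * even_coeff (m + 2) (Suc (Suc n)) =
      (m * even_coeff (m + 2) (Suc n)) * ((2 * of_nat (Suc n))\<^sup>2 - (m + 2)\<^sup>2)"
    by (simp only: even_coeff_Suc[of "m + 2" "Suc n"] mult.assoc)
  then show ?case
    unfolding Suc.IH unfolding even_coeff_Suc of_nat_Suc
    by algebra
qed (simp add: even_coeff_Suc power2_eq_square algebra_simps)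

lemma odd_coeff_recurrence:
  "(m + 2) * odd_coeff (m + 2) (Suc n) + (m - 2) * odd_coeff (m - 2) (Suc n) =
     2 * (m * odd_coeff m (Suc n)) - 4 * (2 * of_nat n + 2) * (2 * of_nat n + 3) * (m * odd_coeff m n)"
proof -
  \<comment> \<open>The downward shift is the upward shift at \<open>- m\<close>, since the product
    depends only on the square of \<open>m\<close>.\<close>
  have "odd_coeff (m - 2) (Suc n) =
      - (2 * of_nat n + 1 - m) * (2 * of_nat n + 3 - m) * odd_coeff m n"
    using odd_coeff_shift[of "- m" n] odd_coeff_minus[of "m - 2" "Suc n"]
    by (simp add: odd_coeff_minus)
  then show ?thesis
    unfolding odd_coeff_shift odd_coeff_Suc[of m] by algebra
qed

lemma even_coeff_recurrence:
  assumes "m \<noteq> 0"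
  shows "even_coeff (m + 2) (Suc n) + even_coeff (m - 2) (Suc n) =
     2 * even_coeff m (Suc n) - 4 * (2 * of_nat n + 1) * (2 * of_nat n + 2) * even_coeff m n"
proof -
  have "- m * even_coeff (m - 2) (Suc n) =
      - (2 - m) * (2 * of_nat n - m) * (2 * of_nat n + 2 - m) * even_coeff m n"
    using even_coeff_shift[of "- m" n] even_coeff_minus[of "m - 2" "Suc n"]
    by (simp add: even_coeff_minus)
  then have "m * (even_coeff (m + 2) (Suc n) + even_coeff (m - 2) (Suc n)) =
     m * (2 * even_coeff m (Suc n) - 4 * (2 * of_nat n + 1) * (2 * of_nat n + 2) * even_coeff m n)"
    using even_coeff_shift[of m n] unfolding even_coeff_Suc[of m] by algebra
  then show ?thesis
    using assms by simp
qed

section \<open>Recurrences for the truncated sums\<close>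

lemma sin_sum_recurrence:
  "sin_sum (Suc N) (m + 2) x + sin_sum (Suc N) (m - 2) x =
     2 * sin_sum (Suc N) m x - 4 * x\<^sup>2 * sin_sum N m x"
proof -
  define t where "t k n = k * odd_coeff k n / fact (2 * n + 1) * x ^ (2 * n + 1)" for k n
  have *: "t (m + 2) (Suc n) + t (m - 2) (Suc n) = 2 * t m (Suc n) - 4 * x\<^sup>2 * t m n" for n
  proof -
    define F :: complex where "F = fact (2 * n + 1)"
    \<comment> \<open>\<open>c\<close> is the quotient of consecutive factorials and also occurs in
      the coefficient recurrence; it cancels there, leaving the preceding term of the sum.\<close>
    define c :: complex where "c = (2 * of_nat n + 2) * (2 * of_nat n + 3)"
    have F: "fact (2 * Suc n + 1) = c * F"
      by (simp add: F_def c_def algebra_simps)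
    have "c * F \<noteq> 0"
      unfolding F[symmetric] by (rule fact_nonzero)
    then have nz: "c \<noteq> 0" "F \<noteq> 0"
      by auto
    have "t (m + 2) (Suc n) + t (m - 2) (Suc n) =
        ((m + 2) * odd_coeff (m + 2) (Suc n) + (m - 2) * odd_coeff (m - 2) (Suc n)) / (c * F)
          * x ^ (2 * Suc n + 1)"
      unfolding t_def F by (simp only: add_divide_distrib distrib_right)
    also have "\<dots> = (2 * (m * odd_coeff m (Suc n)) - 4 * c * (m * odd_coeff m n)) / (c * F)
          * x ^ (2 * Suc n + 1)"
      unfolding odd_coeff_recurrence c_def by (simp only: mult.assoc)
    also have "\<dots> = 2 * t m (Suc n) - 4 * x\<^sup>2 * t m n"
      unfolding t_def F F_def[symmetric] using nz by (simp add: field_simps power2_eq_square)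
    finally show ?thesis .
  qed
  \<comment> \<open>Index 0 has no preceding term, so the sum multiplied by \<open>x\<^sup>2\<close>
    runs only to \<open>N\<close>.\<close>
  have "t (m + 2) 0 + t (m - 2) 0 = 2 * t m 0"
    by (simp add: t_def algebra_simps)
  moreover have "(\<Sum>n\<le>N. t (m + 2) (Suc n)) + (\<Sum>n\<le>N. t (m - 2) (Suc n)) =
      2 * (\<Sum>n\<le>N. t m (Suc n)) - 4 * x\<^sup>2 * (\<Sum>n\<le>N. t m n)"
    unfolding sum.distrib[symmetric] * by (simp add: sum_subtractf sum_distrib_left)
  ultimately show ?thesis
    unfolding sin_sum_def t_def[symmetric] sum.atMost_Suc_shift by (simp add: algebra_simps)
qed

lemma cos_sum_recurrence:
  assumes "m \<noteq> 0"
  shows "cos_sum (Suc N) (m + 2) x + cos_sum (Suc N) (m - 2) x =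
     2 * cos_sum (Suc N) m x - 4 * x\<^sup>2 * cos_sum N m x"
proof -
  define t where "t k n = even_coeff k n / fact (2 * n) * x ^ (2 * n)" for k n
  have *: "t (m + 2) (Suc n) + t (m - 2) (Suc n) = 2 * t m (Suc n) - 4 * x\<^sup>2 * t m n" for n
  proof -
    define F :: complex where "F = fact (2 * n)"
    define c :: complex where "c = (2 * of_nat n + 1) * (2 * of_nat n + 2)"
    have F: "fact (2 * Suc n) = c * F"
      by (simp add: F_def c_def algebra_simps)
    have "c * F \<noteq> 0"
      unfolding F[symmetric] by (rule fact_nonzero)
    then have nz: "c \<noteq> 0" "F \<noteq> 0"
      by auto
    have "t (m + 2) (Suc n) + t (m - 2) (Suc n) =
        (even_coeff (m + 2) (Suc n) + even_coeff (m - 2) (Suc n)) / (c * F) * x ^ (2 * Suc n)"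
      unfolding t_def F by (simp only: add_divide_distrib distrib_right)
    also have "\<dots> = (2 * even_coeff m (Suc n) - 4 * c * even_coeff m n) / (c * F)
          * x ^ (2 * Suc n)"
      unfolding even_coeff_recurrence[OF assms] c_def by (simp only: mult.assoc)
    also have "\<dots> = 2 * t m (Suc n) - 4 * x\<^sup>2 * t m n"
      unfolding t_def F F_def[symmetric] using nz by (simp add: field_simps power2_eq_square)
    finally show ?thesis .
  qed
  have "t (m + 2) 0 + t (m - 2) 0 = 2 * t m 0"
    by (simp add: t_def)
  moreover have "(\<Sum>n\<le>N. t (m + 2) (Suc n)) + (\<Sum>n\<le>N. t (m - 2) (Suc n)) =
      2 * (\<Sum>n\<le>N. t m (Suc n)) - 4 * x\<^sup>2 * (\<Sum>n\<le>N. t m n)"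
    unfolding sum.distrib[symmetric] * by (simp add: sum_subtractf sum_distrib_left)
  ultimately show ?thesis
    unfolding cos_sum_def t_def[symmetric] sum.atMost_Suc_shift by (simp add: algebra_simps)
qed

section \<open>Trigonometric recurrences, initial values and induction\<close>

lemma sin_recurrence:
  fixes \<theta> m :: complex
  shows "sin ((m + 2) * \<theta>) + sin ((m - 2) * \<theta>) = (2 - 4 * (sin \<theta>)\<^sup>2) * sin (m * \<theta>)"
proof -
  have "sin ((m + 2) * \<theta>) + sin ((m - 2) * \<theta>) = 2 * cos (2 * \<theta>) * sin (m * \<theta>)"
    by (simp add: distrib_right left_diff_distrib sin_add sin_diff)
  then show ?thesis
    unfolding cos_double_sin by (simp add: right_diff_distrib)
qed

lemma cos_recurrence:
  fixes \<theta> m :: complex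
  shows "cos ((m + 2) * \<theta>) + cos ((m - 2) * \<theta>) = (2 - 4 * (sin \<theta>)\<^sup>2) * cos (m * \<theta>)"
proof -
  have "cos ((m + 2) * \<theta>) + cos ((m - 2) * \<theta>) = 2 * cos (2 * \<theta>) * cos (m * \<theta>)"
    by (simp add: distrib_right left_diff_distrib cos_add cos_diff)
  then show ?thesis
    unfolding cos_double_sin by (simp add: right_diff_distrib)
qed

text \<open>The factor with \<open>j = 1\<close> vanishes, so only the linear term survives. This
  covers \<open>m = -1\<close> and \<open>m = 1\<close>, both initial values of the
  induction.\<close>

lemma sin_sum_base:
  assumes "m\<^sup>2 = 1"
  shows "sin_sum N m x = m * x"
proof -
  have "odd_coeff m (Suc n) = 0" for n
    by (induction n) (simp_all add: odd_coeff_Suc assms)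
  then show ?thesis
    by (cases N) (simp_all add: sin_sum_def sum.atMost_Suc_shift del: sum.atMost_Suc)
qed

lemma cos_sum_0: "cos_sum N 0 x = 1"
proof -
  have "even_coeff 0 (Suc n) = 0" for n
    by (induction n) (simp_all add: even_coeff_Suc)
  then show ?thesis
    by (cases N) (simp_all add: cos_sum_def sum.atMost_Suc_shift del: sum.atMost_Suc)
qed

text \<open>The factor with \<open>j = 1\<close> vanishes, and the bound \<open>Suc N\<close>
  guarantees that the quadratic term is present.\<close>

lemma cos_sum_2: "cos_sum (Suc N) 2 x = 1 - 2 * x\<^sup>2"
proof -
  have "even_coeff 2 (Suc (Suc n)) = 0" for n
    by (induction n) (simp_all add: even_coeff_Suc)
  then show ?thesis
    by (cases N)
      (simp_all add: cos_sum_def sum.atMost_Suc_shift even_coeff_Suc[of _ 0] power2_eq_square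
        del: sum.atMost_Suc)
qed

text \<open>
  Terms beyond index \<open>s - 1\<close> vanish. Allowing every larger upper bound lets the recurrence, which
  involves two different bounds, be used in the induction; starting at \<open>s = 0\<close>, i.e. \<open>m = -1\<close>,
  makes the base cases trivial.
\<close>

lemma sin_sum_eq_sin:
  assumes "s \<le> Suc N"
  shows "sin_sum N (2 * of_nat s - 1) (sin \<theta>) = sin ((2 * of_nat s - 1) * \<theta>)"
  using assms
proof (induction s arbitrary: N rule: induct_nat_012)
  case (ge2 k)
  define m :: complex where "m = 2 * of_nat (Suc k) - 1"
  have m: "2 * of_nat (Suc (Suc k)) - 1 = m + 2" "2 * of_nat k - 1 = m - 2"
    by (simp_all add: m_def)
  \<comment> \<open>\<open>k \<le> M\<close> is what the induction hypothesis for
    \<open>Suc k\<close> requires at the lowered bound \<open>M\<close>.\<close>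
  obtain M where N: "N = Suc M" "k \<le> M"
    using ge2.prems by (cases N) auto
  have "sin_sum N (m + 2) (sin \<theta>) =
      2 * sin_sum N m (sin \<theta>) - 4 * (sin \<theta>)\<^sup>2 * sin_sum M m (sin \<theta>) - sin_sum N (m - 2) (sin \<theta>)"
    using sin_sum_recurrence[of M m "sin \<theta>"] by (simp add: N algebra_simps)
  also have "\<dots> = (2 - 4 * (sin \<theta>)\<^sup>2) * sin (m * \<theta>) - sin ((m - 2) * \<theta>)"
    using ge2.IH(1)[of N] ge2.IH(2)[of N] ge2.IH(2)[of M] N
    unfolding m m_def[symmetric] by (simp add: algebra_simps)
  also have "\<dots> = sin ((m + 2) * \<theta>)"
    unfolding sin_recurrence[symmetric] by simp
  finally show ?case
    unfolding m .
qed (simp_all add: sin_sum_base)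

text \<open>The factor with \<open>j = s\<close> first enters at index \<open>s + 1\<close>, so the
  bound must reach \<open>s\<close>, one more than for the sine.\<close>

lemma cos_sum_eq_cos:
  assumes "s \<le> N"
  shows "cos_sum N (2 * of_nat s) (sin \<theta>) = cos (2 * of_nat s * \<theta>)"
  using assms
proof (induction s arbitrary: N rule: induct_nat_012)
  case 1
  then show ?case
    by (cases N) (simp_all add: cos_sum_2 cos_double_sin)
next
  case (ge2 k)
  define m :: complex where "m = 2 * of_nat (Suc k)"
  have m: "2 * of_nat (Suc (Suc k)) = m + 2" "2 * of_nat k = m - 2"
    by (simp_all add: m_def)
  have "m \<noteq> 0"
    unfolding m_def by (simp del: of_nat_Suc)
  obtain M where N: "N = Suc M" "Suc k \<le> M"
    using ge2.prems by (cases N) auto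
  have "cos_sum N (m + 2) (sin \<theta>) =
      2 * cos_sum N m (sin \<theta>) - 4 * (sin \<theta>)\<^sup>2 * cos_sum M m (sin \<theta>) - cos_sum N (m - 2) (sin \<theta>)"
    using cos_sum_recurrence[OF \<open>m \<noteq> 0\<close>, of M "sin \<theta>"] by (simp add: N algebra_simps)
  also have "\<dots> = (2 - 4 * (sin \<theta>)\<^sup>2) * cos (m * \<theta>) - cos ((m - 2) * \<theta>)"
    using ge2.IH(1)[of N] ge2.IH(2)[of N] ge2.IH(2)[of M] N
    unfolding m m_def[symmetric] by (simp add: algebra_simps)
  also have "\<dots> = cos ((m + 2) * \<theta>)"
    unfolding cos_recurrence[symmetric] by simp
  finally show ?case
    unfolding m .
qed (simp add: cos_sum_0)

section \<open>From central binomial coefficients to factorials\<close>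

lemma two_of_nat_minus_one_nonzero: "2 * of_nat j - 1 \<noteq> (0 :: complex)"
proof
  assume "2 * of_nat j - 1 = (0 :: complex)"
  then have "of_nat (2 * j) = (of_nat 1 :: complex)"
    by simp
  then have "2 * j = 1"
    by (simp only: of_nat_eq_iff)
  then show False
    by presburger
qed

lemma central_binomial_fact:
  "of_nat (2 * n choose n) = (fact (2 * n) / (fact n)\<^sup>2 :: complex)"
  by (simp add: binomial_fact power2_eq_square mult_2)

text \<open>\<open>2 ^ n * fact n\<close> is the product of the even numbers up to
  \<open>2 * n\<close>, which complements the odd ones.\<close>

lemma prod_odd_numbers:
  "(\<Prod>j = 1..n. 2 * of_nat j - 1) * (2 ^ n * fact n) = (fact (2 * n) :: complex)"
proof (induction n)
  case (Suc n)
  have "(\<Prod>j = 1..Suc n. 2 * of_nat j - 1) * (2 ^ Suc n * fact (Suc n)) =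
      ((\<Prod>j = 1..n. 2 * of_nat j - 1) * (2 ^ n * fact n)) *
        ((2 * of_nat n + 1) * (2 * of_nat n + 2) :: complex)"
    by (simp add: algebra_simps)
  also have "\<dots> = fact (2 * Suc n)"
    unfolding Suc.IH by (simp add: algebra_simps)
  finally show ?case .
qed simp

text \<open>Clearing denominators costs \<open>D\<^sup>2\<close>, with \<open>D\<close> the product
  of the odd numbers, and the binomial prefactor equals
  \<open>D\<^sup>2 / fact (2 * n)\<close>.\<close>

lemma odd_coeff_normalized:
  "of_nat (2 * n choose n) / 4 ^ n * (\<Prod>j = 1..n. 1 - m\<^sup>2 / (2 * of_nat j - 1)\<^sup>2) =
     odd_coeff m n / fact (2 * n)"
proof -
  define D :: complex where "D = (\<Prod>j = 1..n. 2 * of_nat j - 1)"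
  have D: "D \<noteq> 0"
    using two_of_nat_minus_one_nonzero by (simp add: D_def)
  have "(\<Prod>j = 1..n. 1 - m\<^sup>2 / (2 * of_nat j - 1)\<^sup>2) =
      (\<Prod>j = 1..n. ((2 * of_nat j - 1)\<^sup>2 - m\<^sup>2) / (2 * of_nat j - 1)\<^sup>2)"
    using two_of_nat_minus_one_nonzero by (simp add: diff_divide_distrib)
  also have "\<dots> = odd_coeff m n / D\<^sup>2"
    by (simp add: odd_coeff_def D_def prod_dividef prod_power_distrib)
  finally have *: "(\<Prod>j = 1..n. 1 - m\<^sup>2 / (2 * of_nat j - 1)\<^sup>2) = odd_coeff m n / D\<^sup>2" .
  have "fact (2 * n) = D * (2 ^ n * fact n)"
    unfolding D_def by (rule prod_odd_numbers[symmetric])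
  moreover have "(4 :: complex) ^ n = (2 ^ n)\<^sup>2"
    by (simp add: power_mult_distrib[symmetric] power2_eq_square)
  ultimately show ?thesis
    unfolding * central_binomial_fact using D by (simp add: field_simps power2_eq_square)
qed

text \<open>The factor with \<open>j = 0\<close> of \<open>even_coeff\<close> is
  \<open>-4 * s\<^sup>2\<close>; it accounts for the multiplier \<open>s\<^sup>2\<close> and the
  sign.\<close>

lemma even_coeff_normalized:
  "s\<^sup>2 * (4 ^ Suc n / ((of_nat (Suc n))\<^sup>2 * of_nat (2 * Suc n choose Suc n)) *
     (\<Prod>j = 1..n. 1 - s\<^sup>2 / (of_nat j)\<^sup>2)) =
     - even_coeff (2 * s) (Suc n) / fact (2 * Suc n)"
proof -
  have "(\<Prod>j = 1..n. 1 - s\<^sup>2 / (of_nat j)\<^sup>2) =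
      (\<Prod>j = 1..n. ((of_nat j)\<^sup>2 - s\<^sup>2) / (of_nat j)\<^sup>2)"
    by (intro prod.cong) (auto simp: diff_divide_distrib)
  also have "\<dots> = (\<Prod>j = 1..n. (of_nat j)\<^sup>2 - s\<^sup>2) / (fact n)\<^sup>2"
    by (simp add: prod_dividef prod_power_distrib fact_prod)
  finally have *: "(\<Prod>j = 1..n. 1 - s\<^sup>2 / (of_nat j)\<^sup>2) =
      (\<Prod>j = 1..n. (of_nat j)\<^sup>2 - s\<^sup>2) / (fact n)\<^sup>2" .
  have **: "even_coeff (2 * s) (Suc n) = - s\<^sup>2 * 4 ^ Suc n * (\<Prod>j = 1..n. (of_nat j)\<^sup>2 - s\<^sup>2)"
  proof (induction n)
    case (Suc n)
    have "(2 * of_nat (Suc n))\<^sup>2 - (2 * s)\<^sup>2 = 4 * ((of_nat (Suc n))\<^sup>2 - s\<^sup>2)"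
      by (simp add: power2_eq_square algebra_simps)
    then show ?case
      unfolding even_coeff_Suc[of _ "Suc n"] Suc.IH by simp
  qed (simp add: even_coeff_Suc power2_eq_square)
  have "of_nat (Suc n) \<noteq> (0 :: complex)"
    by (simp del: of_nat_Suc)
  then show ?thesis
    unfolding * ** central_binomial_fact fact_Suc[of n]
    by (simp add: field_simps power2_eq_square del: of_nat_Suc fact_Suc mult_Suc_right)
qed

lemma odd_arcsin_sum_eq:
  "(2 * of_nat s - 1) * odd_arcsin_sum s x = sin_sum (s - 1) (2 * of_nat s - 1) x"
proof -
  define m :: complex where "m = 2 * of_nat s - 1"
  have "m * (of_nat (2 * n choose n) / (4 ^ n * (2 * of_nat n + 1)) *
        (\<Prod>j = 1..n. 1 - m\<^sup>2 / (2 * of_nat j - 1)\<^sup>2) * x ^ (2 * n + 1)) =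
      m * odd_coeff m n / fact (2 * n + 1) * x ^ (2 * n + 1)" for n
  proof -
    have "m * (of_nat (2 * n choose n) / (4 ^ n * (2 * of_nat n + 1)) *
        (\<Prod>j = 1..n. 1 - m\<^sup>2 / (2 * of_nat j - 1)\<^sup>2) * x ^ (2 * n + 1)) =
      m * (of_nat (2 * n choose n) / 4 ^ n * (\<Prod>j = 1..n. 1 - m\<^sup>2 / (2 * of_nat j - 1)\<^sup>2))
        / (2 * of_nat n + 1) * x ^ (2 * n + 1)"
      by simp
    then show ?thesis
      unfolding odd_coeff_normalized by (simp add: algebra_simps)
  qed
  then show ?thesis
    unfolding odd_arcsin_sum_def sin_sum_def m_def[symmetric] sum_distrib_left
    by (simp only: atMost_atLeast0)
qed

lemma even_arcsin_sum_eq: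
  "(of_nat s)\<^sup>2 * even_arcsin_sum s x = 1 - cos_sum s (2 * of_nat s) x"
proof -
  have "(of_nat s)\<^sup>2 * (4 ^ n / ((of_nat n)\<^sup>2 * of_nat (2 * n choose n)) *
        (\<Prod>j = 1..n - 1. 1 - (of_nat s)\<^sup>2 / (of_nat j)\<^sup>2) * x ^ (2 * n)) =
      - (even_coeff (2 * of_nat s) n / fact (2 * n) * x ^ (2 * n))"
    if "n \<in> {1..s}" for n
  proof -
    \<comment> \<open>The range excludes \<open>n = 0\<close>, where division by zero makes the left
      side 0 while the right side is -1.\<close>
    obtain k where n: "n = Suc k"
      using \<open>n \<in> {1..s}\<close> by (cases n) auto
    show ?thesis
      unfolding n diff_Suc_1 mult.assoc[symmetric]
      using even_coeff_normalized[of "of_nat s" k]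
      by (simp only: mult.assoc[symmetric] mult_minus_left minus_divide_left [symmetric])
  qed
  then have "(of_nat s)\<^sup>2 * even_arcsin_sum s x =
      - (\<Sum>n = 1..s. even_coeff (2 * of_nat s) n / fact (2 * n) * x ^ (2 * n))"
    unfolding even_arcsin_sum_def sum_distrib_left sum_negf[symmetric] by (intro sum.cong) auto
  \<comment> \<open>The index-0 term of \<open>cos_sum\<close> is 1, which cancels the 1 on the
    right.\<close>
  then show ?thesis
    by (simp add: cos_sum_def atMost_atLeast0 sum.atLeast_Suc_atMost)
qed

section \<open>Specialization to \<open>Arcsin x\<close> and polynomial form\<close>

text \<open>Take \<open>\<theta> = Arcsin x\<close>: \<open>sin (Arcsin x) = x\<close> holds for
  every complex \<open>x\<close>, hence so does the identity.\<close>

lemma odd_arcsin_sum_eq_sin: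
  assumes "s \<ge> 1"
  shows "odd_arcsin_sum s x = sin ((2 * of_nat s - 1) * Arcsin x) / (2 * of_nat s - 1)"
  using odd_arcsin_sum_eq[of s x] sin_sum_eq_sin[of s "s - 1" "Arcsin x"] assms
    two_of_nat_minus_one_nonzero[of s]
  by (simp add: nonzero_eq_divide_eq mult.commute)

lemma even_arcsin_sum_eq_cos:
  assumes "s \<ge> 1"
  shows "even_arcsin_sum s x = (1 - cos (2 * of_nat s * Arcsin x)) / (of_nat s)\<^sup>2"
  using even_arcsin_sum_eq[of s x] cos_sum_eq_cos[of s s "Arcsin x"] assms
  by (simp add: nonzero_eq_divide_eq mult.commute)

text \<open>Each summand is the value at \<open>x\<close> of a \<open>monom\<close>.\<close>

lemma odd_arcsin_sum_poly: "\<exists>p. \<forall>x. odd_arcsin_sum s x = poly p x"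
  unfolding odd_arcsin_sum_def poly_monom[symmetric] poly_sum[symmetric] by blast

lemma even_arcsin_sum_poly: "\<exists>p. \<forall>x. even_arcsin_sum s x = poly p x"
  unfolding even_arcsin_sum_def poly_monom[symmetric] poly_sum[symmetric] by blast

theorem proposition3p3:
  fixes s :: nat
  assumes "s \<ge> 1"
  shows
    "(\<forall>x :: complex. norm x < 1 \<longrightarrow>
        odd_arcsin_sum s x = sin ((2 * of_nat s - 1) * Arcsin x) / (2 * of_nat s - 1)) \<and>
     (\<forall>x :: complex. norm x < 1 \<longrightarrow>
        even_arcsin_sum s x = (1 - cos (2 * of_nat s * Arcsin x)) / (of_nat s)\<^sup>2) \<and>
     (\<exists>p :: complex poly. \<forall>x.
        sin ((2 * of_nat s - 1) * Arcsin x) / (2 * of_nat s - 1) = poly p x) \<and>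
     (\<exists>q :: complex poly. \<forall>x.
        (1 - cos (2 * of_nat s * Arcsin x)) / (of_nat s)\<^sup>2 = poly q x) \<and>
     (\<forall>x :: complex.
        odd_arcsin_sum s x = sin ((2 * of_nat s - 1) * Arcsin x) / (2 * of_nat s - 1)) \<and>
     (\<forall>x :: complex.
        even_arcsin_sum s x = (1 - cos (2 * of_nat s * Arcsin x)) / (of_nat s)\<^sup>2)"
  \<comment> \<open>The identities carry the polynomials representing the sums over to the
    right-hand sides, giving \<open>p\<close> and \<open>q\<close>.\<close>
  using odd_arcsin_sum_poly[of s] even_arcsin_sum_poly[of s]
  by (simp add: odd_arcsin_sum_eq_sin[OF assms] even_arcsin_sum_eq_cos[OF assms])

end
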